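(* Let $d\ge 3$ and let $b=\sum_{j=1}^r b_j\in\bigotimes_{\mu=1}^d\mathbb{R}^{n_\mu}$ with $b_j=\lambda_j\, b_{j1}\otimes\cdots\otimes b_{jd}$, where $\lambda_1\ge\dots\ge\lambda_r>0$ and, for every $\mu\in\{1,\dots,d\}$, the vectors $b_{1\mu},\dots,b_{r\mu}\in\mathbb{R}^{n_\mu}$ are orthonormal. Let $v_k=p_1^k\otimes\cdots\otimes p_d^k$ ($k\ge1$) be the iterates of the alternating least squares (ALS) algorithm for the rank-one approximation of $b$. Suppose that for some $k_0$ and some $j^*\in\{1,\dots,r\}$ the term $b_{j^*}$ dominates at $v_{k_0}$, i.e. $$\lambda_{j^*}^{2/(d-2)}\,\langle b_{j^*\mu},p_\mu^{k_0}\rangle^2>\lambda_{j}^{2/(d-2)}\,\langle b_{j\mu},p_\mu^{k_0}\rangle^2\qquad\text{for all } j\in\{1,\dots,r\}\setminus\{j^*\}\text{ and all }\mu\in\{1,\dots,d\}.$$ Then the ALS iteration converges to $b_{j^*}$, i.e. $v_k\to b_{j^*}$ as $k\to\infty$, and for every $\mu\in\{1,\dots,d\}$ the sequence $\left|\tan\angle[b_{j^*\mu},p_\mu^k]\right|$ converges to $0$ $Q$-superlinearly as $k\to\infty$.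
   Context: The tensor space $\bigotimes_{\mu=1}^d\mathbb{R}^{n_\mu}$ carries the Euclidean inner product $\langle\cdot,\cdot\rangle$. ALS algorithm: start from $(p_1^1,\dots,p_d^1)$ with $p_1^1\otimes\cdots\otimes p_d^1\ne0$. Given $(p_1^k,\dots,p_d^k)$, for $\mu=1,\dots,d$ successively define $p_\mu^{k+1}\in\mathbb{R}^{n_\mu}$ as the vector with $$\langle p_\mu^{k+1},x\rangle=\frac{\langle b,\ p_1^{k+1}\otimes\cdots\otimes p_{\mu-1}^{k+1}\otimes x\otimes p_{\mu+1}^k\otimes\cdots\otimes p_d^k\rangle}{\prod_{\nu<\mu}\|p_\nu^{k+1}\|^2\prod_{\nu>\mu}\|p_\nu^k\|^2}\quad\text{for all }x\in\mathbb{R}^{n_\mu}.$$ $\angle[x,y]$ is the angle between $x$ and $y$, so that for a unit vector $x$ with $\langle x,y\rangle\neq0$ one has $|\tan\angle[x,y]|=\|y-\langle x,y\rangle x\|/|\langle x,y\rangle|$. A nonnegative sequence $(t_k)$ converges to $0$ $Q$-superlinearly if $t_k\to0$ and there are $q_k\ge0$ with $q_k\to0$ and $t_{k+1}\le q_k t_k$ for all sufficiently large $k$. *)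

theory Defs
  imports Complex_Main "HOL-Library.FuncSet" "Jordan_Normal_Form.Matrix"
begin

text \<open>
  The spaces of the vectors have dimensions \<open>n \<mu>\<close> that vary with the mode \<open>\<mu> \<in> {1..d}\<close>, so the
  space of \<open>\<mu>\<close>-th factors is the carrier \<^term>\<open>carrier_vec (n \<mu>)\<close> of real vectors; \<open>\<bullet>\<close> is
  \<^const>\<open>scalar_prod\<close>.  A tensor is its coordinate array, indexed by multi-indices \<open>i\<close> with
  \<open>i \<mu> < n \<mu>\<close> for \<open>\<mu> \<in> {1..d}\<close>, and is zero off these multi-indices.
\<close>

type_synonym tensor = "(nat \<Rightarrow> nat) \<Rightarrow> real"

definition multi_indices :: "nat \<Rightarrow> (nat \<Rightarrow> nat) \<Rightarrow> (nat \<Rightarrow> nat) set" where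
  "multi_indices d n = PiE {1..d} (\<lambda>\<mu>. {..<n \<mu>})"

definition elem_tensor :: "nat \<Rightarrow> (nat \<Rightarrow> nat) \<Rightarrow> (nat \<Rightarrow> real vec) \<Rightarrow> tensor" where
  "elem_tensor d n x = (\<lambda>i. if i \<in> multi_indices d n then (\<Prod>\<mu>=1..d. x \<mu> $ i \<mu>) else 0)"

definition tensor_inner :: "nat \<Rightarrow> (nat \<Rightarrow> nat) \<Rightarrow> tensor \<Rightarrow> tensor \<Rightarrow> real" where
  "tensor_inner d n S T = (\<Sum>i\<in>multi_indices d n. S i * T i)"

definition tensor_norm :: "nat \<Rightarrow> (nat \<Rightarrow> nat) \<Rightarrow> tensor \<Rightarrow> real" where
  "tensor_norm d n T = sqrt (tensor_inner d n T T)"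

definition tensor_tendsto :: "nat \<Rightarrow> (nat \<Rightarrow> nat) \<Rightarrow> (nat \<Rightarrow> tensor) \<Rightarrow> tensor \<Rightarrow> bool" where
  "tensor_tendsto d n v T \<longleftrightarrow> (\<lambda>k. tensor_norm d n (\<lambda>i. v k i - T i)) \<longlonglongrightarrow> 0"

definition vnorm :: "real vec \<Rightarrow> real" where
  "vnorm x = sqrt (x \<bullet> x)"

definition angle :: "real vec \<Rightarrow> real vec \<Rightarrow> real" where
  "angle x y = arccos ((x \<bullet> y) / (vnorm x * vnorm y))"

text \<open>
  \<open>p k \<mu>\<close> is the vector of mode \<open>\<mu>\<close> in the \<open>k\<close>-th iterate; \<open>k\<close> starts at 1 and \<open>p 0\<close> is irrelevant.
  A vanishing denominator means that the algorithm breaks down; by \<open>a / 0 = 0\<close> the updates are then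
  zero from there on, so that an ALS run is well-defined iff all its rank-one tensors are nonzero.
\<close>

definition is_ALS :: "nat \<Rightarrow> (nat \<Rightarrow> nat) \<Rightarrow> tensor \<Rightarrow> (nat \<Rightarrow> nat \<Rightarrow> real vec) \<Rightarrow> bool" where
  "is_ALS d n b p \<longleftrightarrow>
     (\<forall>k\<ge>1. \<forall>\<mu>\<in>{1..d}. p k \<mu> \<in> carrier_vec (n \<mu>)) \<and>
     elem_tensor d n (p 1) \<noteq> (\<lambda>i. 0) \<and>
     (\<forall>k\<ge>1. \<forall>\<mu>\<in>{1..d}. \<forall>x\<in>carrier_vec (n \<mu>).
        p (k + 1) \<mu> \<bullet> x =
          tensor_inner d n b
            (elem_tensor d n (\<lambda>\<nu>. if \<nu> < \<mu> then p (k + 1) \<nu> else if \<nu> = \<mu> then x else p k \<nu>))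
          / ((\<Prod>\<nu>\<in>{1..<\<mu>}. (vnorm (p (k + 1) \<nu>))\<^sup>2) * (\<Prod>\<nu>\<in>{\<mu><..d}. (vnorm (p k \<nu>))\<^sup>2)))"

definition Q_superlinear_to_0 :: "(nat \<Rightarrow> real) \<Rightarrow> bool" where
  "Q_superlinear_to_0 t \<longleftrightarrow>
     (\<forall>k. 0 \<le> t k) \<and> t \<longlonglongrightarrow> 0 \<and>
     (\<exists>q :: nat \<Rightarrow> real. (\<forall>k. 0 \<le> q k) \<and> q \<longlonglongrightarrow> 0 \<and>
        (\<forall>\<^sub>F k in sequentially. t (k + 1) \<le> q k * t k))"

lemma abs_tan_angle_unit:
  assumes x: "x \<in> carrier_vec m" and y: "y \<in> carrier_vec m"
    and unit: "x \<bullet> x = 1" and nz: "x \<bullet> y \<noteq> 0"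
  shows "\<bar>tan (angle x y)\<bar> = vnorm (y - (x \<bullet> y) \<cdot>\<^sub>v x) / \<bar>x \<bullet> y\<bar>"
proof -
  let ?s = "x \<bullet> y"
  have dim: "dim_vec x = m" "dim_vec y = m" using x y by auto
  have sumx: "(\<Sum>i<m. (x $ i)\<^sup>2) = 1"
    using unit dim by (simp add: scalar_prod_def power2_eq_square lessThan_atLeast0)
  have sums: "(\<Sum>i<m. x $ i * y $ i) = ?s"
    using dim by (simp add: scalar_prod_def lessThan_atLeast0)
  have sumy: "(\<Sum>i<m. (y $ i)\<^sup>2) = y \<bullet> y"
    using dim by (simp add: scalar_prod_def power2_eq_square lessThan_atLeast0)
  have res: "y \<bullet> y - ?s\<^sup>2 = (y - ?s \<cdot>\<^sub>v x) \<bullet> (y - ?s \<cdot>\<^sub>v x)"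
  proof -
    have "(y - ?s \<cdot>\<^sub>v x) \<bullet> (y - ?s \<cdot>\<^sub>v x) = (\<Sum>i<m. (y $ i - ?s * x $ i)\<^sup>2)"
      using dim by (simp add: scalar_prod_def power2_eq_square lessThan_atLeast0)
    also have "\<dots> = (\<Sum>i<m. (y $ i)\<^sup>2 - 2 * ?s * (x $ i * y $ i) + ?s\<^sup>2 * (x $ i)\<^sup>2)"
      by (intro sum.cong refl) (simp add: power2_eq_square algebra_simps)
    also have "\<dots> = y \<bullet> y - 2 * ?s * ?s + ?s\<^sup>2 * 1"
      by (simp only: sum.distrib sum_subtractf sum_distrib_left[symmetric] sumx sumy sums)
    finally show ?thesis by (simp add: power2_eq_square)
  qed
  have cs: "?s\<^sup>2 \<le> y \<bullet> y"
    using res scalar_prod_def[of "y - ?s \<cdot>\<^sub>v x" "y - ?s \<cdot>\<^sub>v x"]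
    by (smt (verit) sum_nonneg zero_le_square)
  have pos: "y \<bullet> y > 0" using cs nz by (smt (verit) zero_less_power2)
  have n2: "(vnorm y)\<^sup>2 = y \<bullet> y" and npos: "vnorm y > 0" using pos by (auto simp: vnorm_def)
  let ?c = "?s / vnorm y"
  have c2: "?c\<^sup>2 = ?s\<^sup>2 / (y \<bullet> y)" by (simp add: power_divide n2)
  have "?c\<^sup>2 \<le> 1" using cs pos c2 by (simp add: divide_le_eq)
  hence c1: "\<bar>?c\<bar> \<le> 1" by (simp add: abs_square_le_1)
  have "angle x y = arccos ?c" using unit by (simp add: angle_def vnorm_def)
  hence "\<bar>tan (angle x y)\<bar> = sqrt (1 - ?c\<^sup>2) / \<bar>?c\<bar>"
    unfolding tan_def using sin_arccos_abs[OF c1] cos_arccos_abs[OF c1] \<open>?c\<^sup>2 \<le> 1\<close>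
    by (simp only: abs_divide) (simp add: abs_mult)
  also have "1 - ?c\<^sup>2 = (y \<bullet> y - ?s\<^sup>2) / (y \<bullet> y)" using pos c2 by (simp add: diff_divide_distrib)
  also have "sqrt \<dots> = sqrt (y \<bullet> y - ?s\<^sup>2) / vnorm y" by (simp add: real_sqrt_divide vnorm_def)
  also have "\<dots> / \<bar>?c\<bar> = sqrt (y \<bullet> y - ?s\<^sup>2) / \<bar>?s\<bar>" using npos by (simp add: abs_div)
  also note res
  finally show ?thesis by (simp add: vnorm_def)
qed

end

theory Submission
  imports Defs
begin

text \<open>
  Number the micro-steps of ALS consecutively. Orthonormality decouples the terms: the coefficient
  \<open>c\<^sub>j\<close> of a new factor along the \<open>j\<close>-th term is \<open>\<lambda>\<^sub>j\<close> times the product of the \<open>d - 1\<close> preceding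
  coefficients of the same term, up to a normalization common to all \<open>j\<close>. Hence the ratios
  \<open>x = (\<lambda>\<^sub>j / \<lambda>\<^sub>*)\<^bsup>1/(d-2)\<^esup> |c\<^sub>j / c\<^sub>*|\<close> to the dominant term satisfy
  \<open>x\<^sub>m\<^sub>+\<^sub>d = x\<^sub>m\<^sub>+\<^sub>1 \<dots> x\<^sub>m\<^sub>+\<^sub>d\<^sub>-\<^sub>1\<close>. Dominance says that the first \<open>d\<close> of them are below \<open>1\<close>, so \<open>x\<close>
  tends to \<open>0\<close>, and as \<open>d \<ge> 3\<close> it is eventually decreasing with
  \<open>x\<^sub>m\<^sub>+\<^sub>d \<le> x\<^sub>m x\<^sub>m\<^sub>+\<^sub>d\<^sub>-\<^sub>2\<close>. After one sweep the squared tangent is a weighted sum of squares of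
  these ratios, which gives \<open>Q\<close>-superlinear convergence. The length of the iterate converges
  because the product of \<open>d\<close> successive dominant coefficients is \<open>\<lambda>\<^sub>*\<close> times squared cosines.
\<close>

section \<open>Vector norms and inner products of elementary tensors\<close>

lemma vnorm_square: "(vnorm x)\<^sup>2 = x \<bullet> x"
  by (simp add: vnorm_def scalar_prod_def sum_nonneg)

lemma vnorm_square_sum: "(vnorm x)\<^sup>2 = (\<Sum>i<dim_vec x. (x $ i)\<^sup>2)"
  unfolding vnorm_square by (simp add: scalar_prod_def power2_eq_square lessThan_atLeast0)

lemma abs_entry_le_vnorm:
  assumes "i < dim_vec x"
  shows "\<bar>x $ i\<bar> \<le> vnorm x"
proof -
  have "(x $ i)\<^sup>2 \<le> (vnorm x)\<^sup>2"
    unfolding vnorm_square_sum using assms by (intro member_le_sum) auto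
  moreover have "0 \<le> vnorm x" by (simp add: vnorm_def scalar_prod_def sum_nonneg)
  ultimately show ?thesis using abs_le_square_iff[of "x $ i" "vnorm x"] by simp
qed

lemma vnorm_eq_0_imp_entry:
  assumes "vnorm x = 0" "i < dim_vec x"
  shows "x $ i = 0"
  using abs_entry_le_vnorm[of i x] assms by simp

text \<open>Distributing a product of sums over all choices of indices gives the sum over
  multi-indices. Carriers are required of \<open>y\<close> alone because \<open>scalar_prod\<close>
  sums over the dimension of its second argument.\<close>

lemma tensor_inner_elem_tensor:
  assumes "\<And>\<mu>. \<mu> \<in> {1..d} \<Longrightarrow> y \<mu> \<in> carrier_vec (n \<mu>)"
  shows "tensor_inner d n (elem_tensor d n x) (elem_tensor d n y) = (\<Prod>\<mu>=1..d. x \<mu> \<bullet> y \<mu>)"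
proof -
  have "(\<Prod>\<mu>=1..d. x \<mu> \<bullet> y \<mu>) = (\<Prod>\<mu>=1..d. \<Sum>l\<in>{..<n \<mu>}. x \<mu> $ l * y \<mu> $ l)"
  proof (rule prod.cong[OF refl])
    fix \<mu> assume "\<mu> \<in> {1..d}"
    then have "dim_vec (y \<mu>) = n \<mu>" using assms by auto
    then show "x \<mu> \<bullet> y \<mu> = (\<Sum>l\<in>{..<n \<mu>}. x \<mu> $ l * y \<mu> $ l)"
      by (simp add: scalar_prod_def lessThan_atLeast0)
  qed
  also have "\<dots> = (\<Sum>i\<in>multi_indices d n. \<Prod>\<mu>=1..d. x \<mu> $ i \<mu> * y \<mu> $ i \<mu>)"
    unfolding multi_indices_def by (rule prod_sum_PiE) auto
  also have "\<dots> = tensor_inner d n (elem_tensor d n x) (elem_tensor d n y)"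
    unfolding tensor_inner_def by (intro sum.cong) (auto simp: elem_tensor_def prod.distrib)
  finally show ?thesis by simp
qed

lemma tensor_inner_sum_left:
  "tensor_inner d n (\<lambda>i. \<Sum>j\<in>J. a j * S j i) T = (\<Sum>j\<in>J. a j * tensor_inner d n (S j) T)"
  unfolding tensor_inner_def sum_distrib_left sum_distrib_right
  by (subst sum.swap) (simp only: mult.assoc)

lemma tensor_tendsto_entrywise:
  assumes "\<And>i. i \<in> multi_indices d n \<Longrightarrow> (\<lambda>k. v k i) \<longlonglongrightarrow> T i"
  shows "tensor_tendsto d n v T"
proof -
  have "(\<lambda>k. sqrt (\<Sum>i\<in>multi_indices d n. (v k i - T i) * (v k i - T i)))
          \<longlonglongrightarrow> sqrt (\<Sum>i\<in>multi_indices d n. (T i - T i) * (T i - T i))"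
    by (intro tendsto_real_sqrt tendsto_sum tendsto_mult tendsto_diff assms tendsto_const)
  then show ?thesis
    by (simp add: tensor_tendsto_def tensor_norm_def tensor_inner_def)
qed

lemma elem_tensor_nonzero_imp_vnorm:
  assumes "elem_tensor d n x \<noteq> (\<lambda>i. 0)" "\<mu> \<in> {1..d}" "x \<mu> \<in> carrier_vec (n \<mu>)"
  shows "vnorm (x \<mu>) \<noteq> 0"
proof
  assume 0: "vnorm (x \<mu>) = 0"
  have "elem_tensor d n x i = 0" for i
  proof (cases "i \<in> multi_indices d n")
    case True
    then have "i \<mu> < dim_vec (x \<mu>)" using assms by (auto simp: multi_indices_def)
    then have "x \<mu> $ i \<mu> = 0" by (rule vnorm_eq_0_imp_entry[OF 0])
    then have "(\<Prod>\<mu>=1..d. x \<mu> $ i \<mu>) = 0" using assms(2) by (auto intro!: prod_zero)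
    then show ?thesis by (simp add: elem_tensor_def)
  qed (simp add: elem_tensor_def)
  then show False using assms(1) by auto
qed

subsection \<open>The multiplicative recurrence\<close>

context
  fixes x :: "nat \<Rightarrow> real" and d :: nat
  assumes d: "d \<ge> 3" and nonneg: "\<And>m. 0 \<le> x m" and init: "\<And>m. m < d \<Longrightarrow> x m < 1"
    and rec: "\<And>m. x (m + d) = (\<Prod>i\<in>{1..<d}. x (m + i))"
begin

lemma prod_recurrence_uniform_bound:
  obtains R where "0 \<le> R" "R < 1" "\<And>m. x m \<le> R"
proof -
  define R where "R = Max (x ` {..<d})"
  have fin: "finite (x ` {..<d})" "x ` {..<d} \<noteq> {}" using d by (auto simp: lessThan_empty_iff)
  have R1: "R < 1" unfolding R_def using fin init by (subst Max_less_iff) auto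
  have init_le: "x m \<le> R" if "m < d" for m
    unfolding R_def using fin that by (intro Max_ge) auto
  have R0: "0 \<le> R" using order_trans[OF nonneg init_le, of 0] d by simp
  have "x m \<le> R" for m
  proof (induction m rule: less_induct)
    case (less m)
    show ?case
    proof (cases "m < d")
      case False
      define l where "l = m - d"
      have m: "m = l + d" using False by (simp add: l_def)
      \<comment> \<open>One factor is kept and bounded by \<open>R\<close>; by induction the others
        are at most \<open>R < 1\<close>, hence at most 1.\<close>
      have "x m = x (l + 1) * (\<Prod>i\<in>{1..<d} - {1}. x (l + i))"
        unfolding m rec using d by (intro prod.remove) auto
      also have "\<dots> \<le> R * 1"
      proof (rule mult_mono)
        show "x (l + 1) \<le> R" using m d by (intro less.IH) auto
        show "(\<Prod>i\<in>{1..<d} - {1}. x (l + i)) \<le> 1"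
        proof (rule prod_le_1)
          fix i assume "i \<in> {1..<d} - {1}"
          then have "x (l + i) \<le> R" using m by (intro less.IH) auto
          then show "0 \<le> x (l + i) \<and> x (l + i) \<le> 1" using R1 nonneg by simp
        qed
      qed (use R0 nonneg in \<open>auto intro: prod_nonneg\<close>)
      finally show ?thesis by simp
    qed (rule init_le)
  qed
  from that[OF R0 R1 this] show ?thesis .
qed

lemma prod_recurrence_le_1: "x m \<le> 1"
proof -
  obtain R where "R < 1" "x m \<le> R" by (rule prod_recurrence_uniform_bound) (rule that)
  then show ?thesis by simp
qed

text \<open>Of the \<open>d - 1\<close> factors the two latest are kept and the rest bounded by 1.
  Here \<open>d \<ge> 3\<close> is essential: it makes \<open>d - 1\<close> and \<open>d - 2\<close>
  two distinct indices of the product.\<close>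

lemma prod_recurrence_step: "x (m + d) \<le> x (m + d - 1) * x (m + d - 2)"
proof -
  have "x (m + d) = x (m + (d - 1)) * (\<Prod>i\<in>{1..<d} - {d - 1}. x (m + i))"
    unfolding rec using d by (intro prod.remove) auto
  also have "(\<Prod>i\<in>{1..<d} - {d - 1}. x (m + i))
      = x (m + (d - 2)) * (\<Prod>i\<in>{1..<d} - {d - 1} - {d - 2}. x (m + i))"
    using d by (intro prod.remove) auto
  also have "\<dots> \<le> x (m + (d - 2)) * 1"
    using nonneg prod_recurrence_le_1 by (intro mult_left_mono prod_le_1) auto
  finally have "x (m + d) \<le> x (m + (d - 1)) * (x (m + (d - 2)) * 1)"
    using nonneg by (simp add: mult_left_mono)
  then show ?thesis using d by simp
qed

lemma prod_recurrence_tendsto_0: "x \<longlonglongrightarrow> 0"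
proof -
  obtain R where R: "0 \<le> R" "R < 1" "\<And>m. x m \<le> R"
    by (rule prod_recurrence_uniform_bound) (rule that)
  have "x (m + d) \<le> R ^ m" for m
  proof (induction m)
    case 0
    then show ?case using prod_recurrence_le_1 by simp
  next
    case (Suc m)
    \<comment> \<open>The first factor carries the induction hypothesis, the second contributes one
      more \<open>R\<close>.\<close>
    have "x (Suc m + d) \<le> x (Suc m + d - 1) * x (Suc m + d - 2)"
      by (rule prod_recurrence_step)
    also have "Suc m + d - 1 = m + d" by simp
    also have "x (m + d) * x (Suc m + d - 2) \<le> R ^ m * R"
      using Suc R nonneg by (intro mult_mono) auto
    finally show ?case by (simp only: power_Suc2)
  qed
  moreover have "(\<lambda>m. R ^ m) \<longlonglongrightarrow> 0" using R by (intro LIMSEQ_power_zero) auto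
  ultimately have "(\<lambda>m. x (m + d)) \<longlonglongrightarrow> 0"
    using nonneg by (auto intro!: tendsto_sandwich[of "\<lambda>m. 0" "\<lambda>m. x (m + d)" sequentially "\<lambda>m. R ^ m"])
  then show ?thesis by (rule LIMSEQ_offset)
qed

text \<open>Beyond the initial values the sequence is nonincreasing, so in the two-factor bound the
  later factor may be replaced by \<open>x m\<close>. The other factor tends to 0 and is the source
  of superlinearity.\<close>

lemma prod_recurrence_period_bound:
  assumes m: "m \<ge> d"
  shows "x (m + d) \<le> x m * x (m + d - 2)"
proof -
  have "x (m + i) \<le> x m" for i
  proof (induction i)
    case (Suc i)
    have "x (m + Suc i - d + d) \<le> x (m + Suc i - d + d - 1) * x (m + Suc i - d + d - 2)"
      by (rule prod_recurrence_step)
    also have "m + Suc i - d + d = m + Suc i" using m by simp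
    also have "x (m + Suc i - 1) * x (m + Suc i - 2) \<le> x (m + Suc i - 1) * 1"
      using nonneg prod_recurrence_le_1 by (intro mult_left_mono) auto
    finally show ?case using Suc by simp
  qed simp
  from this[of "d - 1"] have "x (m + d - 1) \<le> x m" using d by simp
  then have "x (m + d - 1) * x (m + d - 2) \<le> x m * x (m + d - 2)"
    using nonneg by (rule mult_right_mono)
  with prod_recurrence_step[of m] show ?thesis by (rule order_trans)
qed

end

subsection \<open>ALS runs on an orthogonally decomposable tensor\<close>

text \<open>The \<open>d - 1\<close> micro-steps after \<open>m\<close> meet every mode except that
  of \<open>m\<close>: earlier modes in the next sweep, later modes in the current one. This is the
  mixture of old and new factors in an ALS update.\<close>

lemma prod_cyclic_window:
  fixes F :: "nat \<Rightarrow> nat \<Rightarrow> 'a::comm_monoid_mult"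
  assumes d: "d > 0"
  shows "(\<Prod>i\<in>{1..<d}. F (K + (m + i) div d) ((m + i) mod d + 1)) =
    (\<Prod>\<nu>\<in>{1..<m mod d + 1}. F (K + m div d + 1) \<nu>) * (\<Prod>\<nu>\<in>{m mod d + 1<..d}. F (K + m div d) \<nu>)"
proof -
  define q s where "q = m div d" and "s = m mod d"
  have m: "m = s + q * d" and s: "s < d" using d by (auto simp: q_def s_def)
  \<comment> \<open>At \<open>i = d - s\<close> the count \<open>s + i\<close> reaches
    \<open>d\<close> and wraps to the first mode of the next sweep.\<close>
  have split: "{1..<d} = {d - s..<d} \<union> {1..<d - s}" "{d - s..<d} \<inter> {1..<d - s} = {}"
    using s by auto
  have 1: "(m + i) div d = q \<and> (m + i) mod d = s + i" if "i \<in> {1..<d - s}" for i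
  proof -
    have e: "m + i = (s + i) + q * d" using m by simp
    have "s + i < d" using that by auto
    then show ?thesis unfolding e by simp
  qed
  have 2: "(m + i) div d = q + 1 \<and> (m + i) mod d = s + i - d" if "i \<in> {d - s..<d}" for i
  proof -
    have e: "m + i = (s + i - d) + (q + 1) * d" using that m s by auto
    have "s + i - d < d" using that s by auto
    then show ?thesis unfolding e using d by (simp only: div_mult_self1 mod_mult_self1 div_less mod_less) simp
  qed
  have "(\<Prod>i\<in>{d - s..<d}. F (K + (m + i) div d) ((m + i) mod d + 1)) = (\<Prod>\<nu>\<in>{1..<s + 1}. F (K + q + 1) \<nu>)"
    using s 2
    by (intro prod.reindex_bij_witness[where i = "\<lambda>\<nu>. \<nu> + d - s - 1" and j = "\<lambda>i. s + i - d + 1"]) auto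
  moreover have "(\<Prod>i\<in>{1..<d - s}. F (K + (m + i) div d) ((m + i) mod d + 1)) = (\<Prod>\<nu>\<in>{s + 1<..d}. F (K + q) \<nu>)"
    using s 1
    by (intro prod.reindex_bij_witness[where i = "\<lambda>\<nu>. \<nu> - s - 1" and j = "\<lambda>i. s + i + 1"]) auto
  ultimately show ?thesis
    unfolding split(1) using split(2)
    by (subst prod.union_disjoint) (auto simp flip: q_def s_def)
qed

text \<open>Dominance appears in square-rooted form. Nonvanishing of the dominant coefficients is a
  separate assumption because dominance implies it only when a second term exists; the starting
  sweep \<open>K\<close> is left free for the same reason.\<close>

locale als_run =
  fixes d r js K :: nat
    and n :: "nat \<Rightarrow> nat"
    and lam :: "nat \<Rightarrow> real"
    and bvec :: "nat \<Rightarrow> nat \<Rightarrow> real vec"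
    and b :: tensor
    and p :: "nat \<Rightarrow> nat \<Rightarrow> real vec"
  assumes d: "d \<ge> 3"
    and bvec_carrier: "\<And>j \<mu>. j \<in> {1..r} \<Longrightarrow> \<mu> \<in> {1..d} \<Longrightarrow> bvec j \<mu> \<in> carrier_vec (n \<mu>)"
    and orthonormal: "\<And>i j \<mu>. i \<in> {1..r} \<Longrightarrow> j \<in> {1..r} \<Longrightarrow> \<mu> \<in> {1..d} \<Longrightarrow>
          bvec i \<mu> \<bullet> bvec j \<mu> = (if i = j then 1 else 0)"
    and lam_pos: "\<And>j. j \<in> {1..r} \<Longrightarrow> lam j > 0"
    and b_eq: "b = (\<lambda>i. \<Sum>j=1..r. lam j * elem_tensor d n (bvec j) i)"
    and als: "is_ALS d n b p"
    and K: "K \<ge> 1"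
    and js: "js \<in> {1..r}"
    and nonzero_init: "\<And>\<mu>. \<mu> \<in> {1..d} \<Longrightarrow> bvec js \<mu> \<bullet> p K \<mu> \<noteq> 0"
    and dominant: "\<And>j \<mu>. j \<in> {1..r} - {js} \<Longrightarrow> \<mu> \<in> {1..d} \<Longrightarrow>
          lam j powr (1 / (real d - 2)) * \<bar>bvec j \<mu> \<bullet> p K \<mu>\<bar>
            < lam js powr (1 / (real d - 2)) * \<bar>bvec js \<mu> \<bullet> p K \<mu>\<bar>"
begin

text \<open>The micro-steps of all sweeps are numbered consecutively from sweep \<open>K\<close> on: step \<open>m + d\<close>
  replaces the vector \<open>P m\<close>, and the other vectors in use are \<open>P (m + 1), \<dots>, P (m + d - 1)\<close>.\<close>

definition mode :: "nat \<Rightarrow> nat" where "mode m = m mod d + 1"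
definition P :: "nat \<Rightarrow> real vec" where "P m = p (K + m div d) (mode m)"
definition B :: "nat \<Rightarrow> nat \<Rightarrow> real vec" where "B j m = bvec j (mode m)"
definition c :: "nat \<Rightarrow> nat \<Rightarrow> real" where "c j m = B j m \<bullet> P m"

lemma mode_in: "mode m \<in> {1..d}"
  using d mod_less_divisor[of d m] by (auto simp: mode_def Suc_le_eq simp del: mod_less_divisor)

lemma mode_add_d [simp]: "mode (m + d) = mode m"
  by (simp add: mode_def)

lemma B_add_d [simp]: "B j (m + d) = B j m"
  by (simp add: B_def)

lemma P_carrier: "P m \<in> carrier_vec (n (mode m))"
  using als K mode_in[of m] by (auto simp: is_ALS_def P_def)

lemma B_carrier: "j \<in> {1..r} \<Longrightarrow> B j m \<in> carrier_vec (n (mode m))"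
  using bvec_carrier mode_in by (simp add: B_def)

lemma B_orthonormal: "i \<in> {1..r} \<Longrightarrow> j \<in> {1..r} \<Longrightarrow> B i m \<bullet> B j m = (if i = j then 1 else 0)"
  using orthonormal mode_in by (simp add: B_def)

lemma c_comm: "j \<in> {1..r} \<Longrightarrow> P m \<bullet> B j m = c j m"
  unfolding c_def by (rule comm_scalar_prod[OF P_carrier B_carrier])

lemma als_update:
  assumes x: "x \<in> carrier_vec (n (mode m))"
  shows "P (m + d) \<bullet> x = (\<Sum>j=1..r. lam j * ((\<Prod>i\<in>{1..<d}. c j (m + i)) * (B j m \<bullet> x))) /
           (\<Prod>i\<in>{1..<d}. (vnorm (P (m + i)))\<^sup>2)"
proof -
  define k \<mu> where "k = K + m div d" and "\<mu> = mode m"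
  define y where "y = (\<lambda>\<nu>. if \<nu> < \<mu> then p (k + 1) \<nu> else if \<nu> = \<mu> then x else p k \<nu>)"
  have \<mu>: "\<mu> \<in> {1..d}" unfolding \<mu>_def by (rule mode_in)
  have k: "k \<ge> 1" using K by (simp add: k_def)
  have d0: "d > 0" using d by simp
  have P_next: "P (m + d) = p (k + 1) \<mu>"
    using d0 by (simp add: P_def k_def \<mu>_def)
  \<comment> \<open>A generic \<open>f\<close> lets one reindexing serve both the coefficients in
    the numerator and the squared norms in the denominator.\<close>
  have window: "(\<Prod>i\<in>{1..<d}. f (p (K + (m + i) div d) (mode (m + i))) (mode (m + i))) =
      (\<Prod>\<nu>\<in>{1..<\<mu>}. f (p (k + 1) \<nu>) \<nu>) * (\<Prod>\<nu>\<in>{\<mu><..d}. f (p k \<nu>) \<nu>)"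
    for f :: "real vec \<Rightarrow> nat \<Rightarrow> real"
    using prod_cyclic_window[OF d0, of "\<lambda>k \<nu>. f (p k \<nu>) \<nu>" K m]
    unfolding k_def \<mu>_def mode_def by simp
  have y_carrier: "y \<nu> \<in> carrier_vec (n \<nu>)" if "\<nu> \<in> {1..d}" for \<nu>
    using als k that x by (auto simp: is_ALS_def y_def \<mu>_def)
  have prod_y: "(\<Prod>\<nu>=1..d. bvec j \<nu> \<bullet> y \<nu>) = (\<Prod>i\<in>{1..<d}. c j (m + i)) * (B j m \<bullet> x)" for j
  proof -
    have "{1..d} = insert \<mu> ({1..<\<mu>} \<union> {\<mu><..d})" using \<mu> by auto
    moreover have "{1..<\<mu>} \<inter> {\<mu><..d} = {}" by auto
    ultimately have "(\<Prod>\<nu>=1..d. bvec j \<nu> \<bullet> y \<nu>) = (bvec j \<mu> \<bullet> y \<mu>) *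
        ((\<Prod>\<nu>\<in>{1..<\<mu>}. bvec j \<nu> \<bullet> y \<nu>) * (\<Prod>\<nu>\<in>{\<mu><..d}. bvec j \<nu> \<bullet> y \<nu>))"
      by (simp add: prod.union_disjoint del: One_nat_def)
    also have "(\<Prod>\<nu>\<in>{1..<\<mu>}. bvec j \<nu> \<bullet> y \<nu>) = (\<Prod>\<nu>\<in>{1..<\<mu>}. bvec j \<nu> \<bullet> p (k + 1) \<nu>)"
      by (intro prod.cong) (auto simp: y_def)
    also have "(\<Prod>\<nu>\<in>{\<mu><..d}. bvec j \<nu> \<bullet> y \<nu>) = (\<Prod>\<nu>\<in>{\<mu><..d}. bvec j \<nu> \<bullet> p k \<nu>)"
      by (intro prod.cong) (auto simp: y_def)
    also note window[of "\<lambda>v \<nu>. bvec j \<nu> \<bullet> v", symmetric]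
    finally show ?thesis by (simp add: c_def P_def B_def \<mu>_def y_def)
  qed
  have "P (m + d) \<bullet> x = tensor_inner d n b (elem_tensor d n y)
      / ((\<Prod>\<nu>\<in>{1..<\<mu>}. (vnorm (p (k + 1) \<nu>))\<^sup>2) * (\<Prod>\<nu>\<in>{\<mu><..d}. (vnorm (p k \<nu>))\<^sup>2))"
    using als k \<mu> x unfolding is_ALS_def P_next y_def \<mu>_def by blast
  also have "(\<Prod>\<nu>\<in>{1..<\<mu>}. (vnorm (p (k + 1) \<nu>))\<^sup>2) * (\<Prod>\<nu>\<in>{\<mu><..d}. (vnorm (p k \<nu>))\<^sup>2)
      = (\<Prod>i\<in>{1..<d}. (vnorm (P (m + i)))\<^sup>2)"
    using window[of "\<lambda>v \<nu>. (vnorm v)\<^sup>2"] by (simp add: P_def)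
  also have "tensor_inner d n b (elem_tensor d n y)
      = (\<Sum>j=1..r. lam j * (\<Prod>\<nu>=1..d. bvec j \<nu> \<bullet> y \<nu>))"
    unfolding b_eq tensor_inner_sum_left by (simp only: tensor_inner_elem_tensor[OF y_carrier])
  finally show ?thesis by (simp only: prod_y)
qed

text \<open>Testing the update with \<open>B j m\<close> leaves a single summand by orthonormality,
  so the terms decouple.\<close>

lemma c_update:
  assumes j: "j \<in> {1..r}"
  shows "c j (m + d) = lam j * (\<Prod>i\<in>{1..<d}. c j (m + i)) / (\<Prod>i\<in>{1..<d}. (vnorm (P (m + i)))\<^sup>2)"
proof -
  have "c j (m + d) = P (m + d) \<bullet> B j m" using c_comm[OF j, of "m + d"] by simp
  also have "\<dots> = (\<Sum>l=1..r. lam l * ((\<Prod>i\<in>{1..<d}. c l (m + i)) * (B l m \<bullet> B j m))) /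
           (\<Prod>i\<in>{1..<d}. (vnorm (P (m + i)))\<^sup>2)"
    by (rule als_update[OF B_carrier[OF j]])
  also have "(\<Sum>l=1..r. lam l * ((\<Prod>i\<in>{1..<d}. c l (m + i)) * (B l m \<bullet> B j m)))
     = (\<Sum>l=1..r. if l = j then lam l * (\<Prod>i\<in>{1..<d}. c l (m + i)) else 0)"
    using j by (intro sum.cong refl) (simp add: B_orthonormal)
  also have "\<dots> = lam j * (\<Prod>i\<in>{1..<d}. c j (m + i))" using j by simp
  finally show ?thesis .
qed

text \<open>An updated factor lies in the span of the \<open>B j m\<close>. The index is
  \<open>m + d\<close> because the vectors of sweep \<open>K\<close> may have components outside
  that span.\<close>

lemma P_expansion:
  assumes x: "x \<in> carrier_vec (n (mode m))"
  shows "P (m + d) \<bullet> x = (\<Sum>j=1..r. c j (m + d) * (B j m \<bullet> x))"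
  unfolding als_update[OF x] sum_divide_distrib
  by (intro sum.cong refl) (simp add: c_update)

lemma P_square: "P (m + d) \<bullet> P (m + d) = (\<Sum>j=1..r. (c j (m + d))\<^sup>2)"
  using P_expansion[of "P (m + d)" m] P_carrier[of "m + d"]
  by (simp add: c_def power2_eq_square)

lemma c_nonzero_imp_vnorm:
  assumes "c j m \<noteq> 0"
  shows "vnorm (P m) \<noteq> 0"
proof
  assume "vnorm (P m) = 0"
  then have "P m $ l = 0" if "l < dim_vec (P m)" for l
    using vnorm_eq_0_imp_entry that by blast
  then have "c j m = 0" by (auto simp: c_def scalar_prod_def intro!: sum.neutral)
  then show False using assms by simp
qed

text \<open>No breakdown occurs from sweep \<open>K\<close> on: nonzero coefficients force nonzero
  norms, so both numerator and denominator of the next update are nonzero.\<close>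

lemma c_js_nonzero: "c js m \<noteq> 0"
proof (induction m rule: less_induct)
  case (less m)
  show ?case
  proof (cases "m < d")
    case True
    then show ?thesis using nonzero_init[OF mode_in[of m]] by (simp add: c_def B_def P_def)
  next
    case False
    define l where "l = m - d"
    have m: "m = l + d" using False by (simp add: l_def)
    have nz: "c js (l + i) \<noteq> 0" if "i \<in> {1..<d}" for i
      using less.IH[of "l + i"] that m by simp
    then have "vnorm (P (l + i)) \<noteq> 0" if "i \<in> {1..<d}" for i
      using c_nonzero_imp_vnorm that by blast
    then show ?thesis using nz lam_pos[OF js] unfolding m c_update[OF js] by simp
  qed
qed

lemma vnorm_P_nonzero: "vnorm (P m) \<noteq> 0"
  using c_js_nonzero c_nonzero_imp_vnorm by blast

section \<open>Weighted ratios of the coefficients to the dominant one\<close>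

definition alpha :: "nat \<Rightarrow> real" where "alpha j = lam j powr (1 / (real d - 2))"

lemma alpha_pos: "j \<in> {1..r} \<Longrightarrow> alpha j > 0"
  using lam_pos[of j] by (simp add: alpha_def)

lemma alpha_power: "j \<in> {1..r} \<Longrightarrow> alpha j ^ (d - 1) = alpha j * lam j"
proof -
  assume j: "j \<in> {1..r}"
  have "alpha j ^ (d - 2) = lam j"
    using lam_pos[OF j] d
    by (simp add: alpha_def flip: powr_realpow) (simp add: powr_powr)
  moreover have "d - 1 = Suc (d - 2)" using d by simp
  ultimately show ?thesis by simp
qed

text \<open>The weights \<open>alpha j\<close> are the ones that absorb the factor \<open>lam j\<close> of the update: since
  \<open>alpha j ^ (d - 1) = alpha j * lam j\<close>, the weighted ratios satisfy a pure product recurrence.\<close>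

definition ratio :: "nat \<Rightarrow> nat \<Rightarrow> real" where
  "ratio j m = (alpha j * \<bar>c j m\<bar>) / (alpha js * \<bar>c js m\<bar>)"

lemma ratio_nonneg: "j \<in> {1..r} \<Longrightarrow> 0 \<le> ratio j m"
  using alpha_pos[of j] alpha_pos[OF js] by (simp add: ratio_def)

lemma ratio_init:
  assumes "j \<in> {1..r} - {js}" "m < d"
  shows "ratio j m < 1"
  using dominant[OF assms(1) mode_in[of m]] assms(2) alpha_pos[OF js] c_js_nonzero[of m]
  by (simp add: ratio_def divide_less_eq c_def B_def P_def alpha_def)

text \<open>Each of the \<open>d - 1\<close> coefficients absorbs one weight, which uses up
  \<open>lam\<close> and leaves one weight for the new coefficient. The normalization
  \<open>D\<close> is common to all terms and cancels in the quotient.\<close>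

lemma ratio_rec:
  assumes j: "j \<in> {1..r}"
  shows "ratio j (m + d) = (\<Prod>i\<in>{1..<d}. ratio j (m + i))"
proof -
  define D where "D = (\<Prod>i\<in>{1..<d}. (vnorm (P (m + i)))\<^sup>2)"
  have D: "D > 0" unfolding D_def using vnorm_P_nonzero by (intro prod_pos) simp
  have *: "alpha l * \<bar>c l (m + d)\<bar> = (\<Prod>i\<in>{1..<d}. alpha l * \<bar>c l (m + i)\<bar>) / D" if l: "l \<in> {1..r}" for l
  proof -
    have "(\<Prod>i\<in>{1..<d}. alpha l * \<bar>c l (m + i)\<bar>) = alpha l * lam l * (\<Prod>i\<in>{1..<d}. \<bar>c l (m + i)\<bar>)"
      using alpha_power[OF l] by (simp add: prod.distrib)
    then show ?thesis
      using lam_pos[OF l] D unfolding c_update[OF l] D_def[symmetric]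
      by (simp add: abs_mult abs_prod)
  qed
  show ?thesis
    unfolding ratio_def *[OF j] *[OF js] using D by (simp add: prod_dividef)
qed

lemma ratio_tendsto_0: "j \<in> {1..r} - {js} \<Longrightarrow> ratio j \<longlonglongrightarrow> 0"
  using d ratio_nonneg ratio_init ratio_rec by (intro prod_recurrence_tendsto_0[of d]) auto

lemma ratio_period_bound:
  "j \<in> {1..r} - {js} \<Longrightarrow> m \<ge> d \<Longrightarrow> ratio j (m + d) \<le> ratio j m * ratio j (m + d - 2)"
  using d ratio_nonneg ratio_init ratio_rec by (intro prod_recurrence_period_bound[of d "ratio j"]) auto

section \<open>Tangents at the micro-steps and their decay\<close>

definition t :: "nat \<Rightarrow> real" where "t m = \<bar>tan (angle (B js m) (P m))\<bar>"

definition residual :: "nat \<Rightarrow> real vec" where "residual m = P m - c js m \<cdot>\<^sub>v B js m"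

lemma t_eq: "t m = vnorm (residual m) / \<bar>c js m\<bar>"
  unfolding t_def residual_def using abs_tan_angle_unit[OF B_carrier[OF js] P_carrier, of m]
    B_orthonormal[OF js js, of m] c_js_nonzero[of m]
  by (simp flip: c_def)

lemma residual_square: "residual m \<bullet> residual m = P m \<bullet> P m - (c js m)\<^sup>2"
proof -
  have carr: "B js m \<in> carrier_vec (n (mode m))" "P m \<in> carrier_vec (n (mode m))"
      "c js m \<cdot>\<^sub>v B js m \<in> carrier_vec (n (mode m))" "residual m \<in> carrier_vec (n (mode m))"
    using B_carrier[OF js, of m] P_carrier[of m] by (auto simp: residual_def)
  show ?thesis
    using carr B_orthonormal[OF js js, of m]
    by (simp add: residual_def minus_scalar_prod_distrib[of _ "n (mode m)"]
        scalar_prod_minus_distrib[of _ "n (mode m)"] c_comm[OF js] power2_eq_square flip: c_def)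
qed

text \<open>By Parseval the residual consists of the non-dominant coefficients; this needs an
  updated vector, hence \<open>m \<ge> d\<close>.\<close>

lemma t_square:
  assumes "m \<ge> d"
  shows "(t m)\<^sup>2 = (\<Sum>j\<in>{1..r} - {js}. (alpha js / alpha j * ratio j m)\<^sup>2)"
proof -
  obtain l where m: "m = l + d" using assms by (metis add.commute le_iff_add)
  have "residual m \<bullet> residual m = (\<Sum>j\<in>{1..r} - {js}. (c j m)\<^sup>2)"
    unfolding residual_square m P_square using js by (subst sum.remove[of _ js]) auto
  then have "(t m)\<^sup>2 = (\<Sum>j\<in>{1..r} - {js}. (c j m)\<^sup>2) / (c js m)\<^sup>2"
    by (simp add: t_eq power_divide vnorm_square)
  also have "\<dots> = (\<Sum>j\<in>{1..r} - {js}. (alpha js / alpha j * ratio j m)\<^sup>2)"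
    unfolding sum_divide_distrib
  proof (intro sum.cong refl)
    fix j assume "j \<in> {1..r} - {js}"
    then have "alpha j > 0" "alpha js > 0" using alpha_pos js by auto
    then show "(c j m)\<^sup>2 / (c js m)\<^sup>2 = (alpha js / alpha j * ratio j m)\<^sup>2"
      by (simp add: ratio_def power_divide power_mult_distrib)
  qed
  finally show ?thesis .
qed

lemma t_nonneg: "0 \<le> t m"
  by (simp add: t_def)

lemma t_tendsto_0: "t \<longlonglongrightarrow> 0"
proof -
  have "(\<lambda>m. \<Sum>j\<in>{1..r} - {js}. (alpha js / alpha j * ratio j m)\<^sup>2)
      \<longlonglongrightarrow> (\<Sum>j\<in>{1..r} - {js}. (alpha js / alpha j * 0)\<^sup>2)"
    by (intro tendsto_sum tendsto_power tendsto_mult tendsto_const ratio_tendsto_0)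
  then have lim: "(\<lambda>m. \<Sum>j\<in>{1..r} - {js}. (alpha js / alpha j * ratio j m)\<^sup>2) \<longlonglongrightarrow> 0"
    by simp
  have "(\<lambda>m. (t m)\<^sup>2) \<longlonglongrightarrow> 0"
    by (rule Lim_transform_eventually[OF lim], rule eventually_sequentiallyI[of d]) (simp only: t_square)
  from tendsto_real_sqrt[OF this] show ?thesis by (simp add: t_nonneg)
qed

text \<open>The index is that of the extra factor in \<open>ratio_period_bound\<close>; summing over
  \<open>j\<close> gives one factor that dominates those of all terms and still tends to 0.\<close>

definition rate :: "nat \<Rightarrow> real" where "rate m = (\<Sum>j\<in>{1..r} - {js}. ratio j (m + d - 2))"

lemma rate_nonneg: "0 \<le> rate m"
  unfolding rate_def using ratio_nonneg by (intro sum_nonneg) auto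

lemma rate_tendsto_0: "rate \<longlonglongrightarrow> 0"
proof -
  have "rate = (\<lambda>m. \<Sum>j\<in>{1..r} - {js}. ratio j (m + (d - 2)))"
    using d by (simp add: rate_def fun_eq_iff)
  also have "\<dots> \<longlonglongrightarrow> (\<Sum>j\<in>{1..r} - {js}. 0)"
    by (intro tendsto_sum LIMSEQ_ignore_initial_segment[OF ratio_tendsto_0])
  finally show ?thesis by simp
qed

lemma ratio_le_rate: "j \<in> {1..r} - {js} \<Longrightarrow> ratio j (m + d - 2) \<le> rate m"
  unfolding rate_def
  by (rule member_le_sum[where f = "\<lambda>j. ratio j (m + d - 2)"]) (auto intro: ratio_nonneg)

text \<open>Over one sweep every ratio gains a factor of at most \<open>rate m\<close>, which is
  common to all summands and leaves the sum of squares.\<close>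

lemma t_period_bound:
  assumes m: "m \<ge> d"
  shows "t (m + d) \<le> rate m * t m"
proof (rule power2_le_imp_le)
  have "(t (m + d))\<^sup>2 = (\<Sum>j\<in>{1..r} - {js}. (alpha js / alpha j * ratio j (m + d))\<^sup>2)"
    by (rule t_square) simp
  also have "\<dots> \<le> (\<Sum>j\<in>{1..r} - {js}. (rate m * (alpha js / alpha j * ratio j m))\<^sup>2)"
  proof (rule sum_mono, rule power_mono)
    fix j assume j: "j \<in> {1..r} - {js}"
    then have w: "0 \<le> alpha js / alpha j"
      using alpha_pos[OF js] alpha_pos[of j] by simp
    have r0: "0 \<le> ratio j l" for l using j ratio_nonneg by blast
    have "ratio j (m + d) \<le> ratio j m * ratio j (m + d - 2)"
      using j m by (rule ratio_period_bound)
    also have "\<dots> \<le> ratio j m * rate m"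
      by (rule mult_left_mono[OF ratio_le_rate[OF j] r0])
    finally have "alpha js / alpha j * ratio j (m + d) \<le> alpha js / alpha j * (ratio j m * rate m)"
      using w by (rule mult_left_mono)
    then show "alpha js / alpha j * ratio j (m + d) \<le> rate m * (alpha js / alpha j * ratio j m)"
      by (simp only: mult_ac)
    show "0 \<le> alpha js / alpha j * ratio j (m + d)"
      by (rule mult_nonneg_nonneg[OF w r0])
  qed
  also have "\<dots> = (rate m * t m)\<^sup>2"
    by (simp only: t_square[OF m] power_mult_distrib[of "rate m"] sum_distrib_left)
  finally show "(t (m + d))\<^sup>2 \<le> (rate m * t m)\<^sup>2" .
  show "0 \<le> rate m * t m" by (rule mult_nonneg_nonneg[OF rate_nonneg t_nonneg])
qed

section \<open>From micro-steps back to the sweeps of ALS\<close>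

lemma P_at:
  assumes "\<mu> \<in> {1..d}"
  shows "mode (d * k + (\<mu> - 1)) = \<mu>" "P (d * k + (\<mu> - 1)) = p (K + k) \<mu>" "B j (d * k + (\<mu> - 1)) = bvec j \<mu>"
proof -
  define e where "e = \<mu> - 1"
  have "\<mu> = e + 1" "e < d" using assms by (auto simp: e_def)
  then have "(d * k + (\<mu> - 1)) div d = k" "mode (d * k + (\<mu> - 1)) = \<mu>"
    by (simp_all add: mode_def)
  then show "mode (d * k + (\<mu> - 1)) = \<mu>" "P (d * k + (\<mu> - 1)) = p (K + k) \<mu>" "B j (d * k + (\<mu> - 1)) = bvec j \<mu>"
    by (simp_all add: P_def B_def)
qed

lemma filterlim_period: "filterlim (\<lambda>k. d * k + e) sequentially sequentially"
  using d by (intro filterlim_subseq strict_monoI) auto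

lemma tan_Q_superlinear:
  assumes \<mu>: "\<mu> \<in> {1..d}"
  shows "Q_superlinear_to_0 (\<lambda>k. \<bar>tan (angle (bvec js \<mu>) (p k \<mu>))\<bar>)"
  unfolding Q_superlinear_to_0_def
\<comment> \<open>The witness is the rate at the micro-step of mode \<mu> in sweep \<open>k\<close>.
  For \<open>k < K\<close> the subtraction truncates, and only nonnegativity matters there.\<close>
proof (intro conjI allI exI[of _ "\<lambda>k. rate (d * (k - K) + (\<mu> - 1))"])
  have T: "\<bar>tan (angle (bvec js \<mu>) (p (k + K) \<mu>))\<bar> = t (d * k + (\<mu> - 1))" for k
    by (simp only: t_def P_at[OF \<mu>] add.commute[of k K])
  show "(\<lambda>k. \<bar>tan (angle (bvec js \<mu>) (p k \<mu>))\<bar>) \<longlonglongrightarrow> 0"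
    by (rule LIMSEQ_offset[of _ K]) (unfold T, rule filterlim_compose[OF t_tendsto_0 filterlim_period])
  show "(\<lambda>k. rate (d * (k - K) + (\<mu> - 1))) \<longlonglongrightarrow> 0"
    by (rule LIMSEQ_offset[of _ K]) (simp, rule filterlim_compose[OF rate_tendsto_0 filterlim_period])
  show "\<forall>\<^sub>F k in sequentially. \<bar>tan (angle (bvec js \<mu>) (p (k + 1) \<mu>))\<bar>
      \<le> rate (d * (k - K) + (\<mu> - 1)) * \<bar>tan (angle (bvec js \<mu>) (p k \<mu>))\<bar>"
  \<comment> \<open>One full sweep after \<open>K\<close> puts the micro-step index at
    \<open>d\<close> or above, as \<open>t_period_bound\<close> demands.\<close>
  proof (rule eventually_sequentiallyI[of "K + 1"])
    fix k assume "K + 1 \<le> k"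
    then obtain l where k: "k = l + 1 + K" by (metis add.commute add.assoc le_iff_add)
    have "t (d * (l + 1) + (\<mu> - 1) + d) \<le> rate (d * (l + 1) + (\<mu> - 1)) * t (d * (l + 1) + (\<mu> - 1))"
      by (rule t_period_bound) simp
    moreover have "d * (l + 1) + (\<mu> - 1) + d = d * (l + 1 + 1) + (\<mu> - 1)" by simp
    moreover have "k + 1 = l + 1 + 1 + K" "k - K = l + 1" using k by auto
    ultimately show "\<bar>tan (angle (bvec js \<mu>) (p (k + 1) \<mu>))\<bar>
      \<le> rate (d * (k - K) + (\<mu> - 1)) * \<bar>tan (angle (bvec js \<mu>) (p k \<mu>))\<bar>"
      using T[of "l + 1 + 1"] T[of "l + 1"] k by metis
  qed
qed (simp_all add: rate_nonneg)

section \<open>Length of the iterates and convergence of the tensors\<close>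

lemma c_window:
  "(\<Prod>\<nu>=1..d. c js (m + \<nu>)) = lam js * (\<Prod>i\<in>{1..<d}. 1 / (1 + (t (m + i))\<^sup>2))"
proof -
  have q: "(c js l)\<^sup>2 / (vnorm (P l))\<^sup>2 = 1 / (1 + (t l)\<^sup>2)" for l
  proof -
    have "(t l)\<^sup>2 = ((vnorm (P l))\<^sup>2 - (c js l)\<^sup>2) / (c js l)\<^sup>2"
      by (simp add: t_eq power_divide vnorm_square residual_square)
    then have "1 + (t l)\<^sup>2 = (vnorm (P l))\<^sup>2 / (c js l)\<^sup>2"
      using c_js_nonzero[of l] by (simp add: field_simps)
    then show ?thesis by simp
  qed
  have "{1..d} = insert d {1..<d}" using d by auto
  then have "(\<Prod>\<nu>=1..d. c js (m + \<nu>)) = c js (m + d) * (\<Prod>i\<in>{1..<d}. c js (m + i))" by simp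
  \<comment> \<open>The update of \<open>c js (m + d)\<close> supplies a second copy of the other
    \<open>d - 1\<close> coefficients, so squared cosines arise and all signs disappear.\<close>
  also have "\<dots> = lam js * (\<Prod>i\<in>{1..<d}. (c js (m + i))\<^sup>2 / (vnorm (P (m + i)))\<^sup>2)"
    by (simp add: c_update[OF js] prod_dividef power2_eq_square prod.distrib)
  finally show ?thesis by (simp only: q)
qed

lemma P_entry_close:
  assumes "l < n (mode m)"
  shows "\<bar>P m $ l / c js m - B js m $ l\<bar> \<le> t m"
proof -
  have dim: "dim_vec (P m) = n (mode m)" "dim_vec (B js m) = n (mode m)"
    using P_carrier[of m] B_carrier[OF js, of m] by auto
  have "residual m $ l = P m $ l - c js m * B js m $ l"
    using dim assms by (simp add: residual_def)
  then have "P m $ l / c js m - B js m $ l = residual m $ l / c js m"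
    using c_js_nonzero[of m] by (simp add: diff_divide_distrib)
  then have "\<bar>P m $ l / c js m - B js m $ l\<bar> = \<bar>residual m $ l\<bar> / \<bar>c js m\<bar>"
    by simp
  also have "\<dots> \<le> t m"
    unfolding t_eq using dim assms
    by (intro divide_right_mono abs_entry_le_vnorm) (auto simp: residual_def)
  finally show ?thesis .
qed

text \<open>Dividing each factor by its dominant coefficient makes it converge to
  \<open>bvec js\<close>; the extracted product of coefficients tends to \<open>lam js\<close>
  because all cosines tend to 1 in absolute value.\<close>

lemma elem_tensor_tendsto:
  assumes i: "i \<in> multi_indices d n"
  shows "(\<lambda>k. elem_tensor d n (p k) i) \<longlonglongrightarrow> lam js * elem_tensor d n (bvec js) i"
proof (rule LIMSEQ_offset[of _ "K + 1"])
  \<comment> \<open>\<open>M k\<close> is the last micro-step of sweep \<open>K + k\<close>, so the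
    window \<open>M k + 1, ..., M k + d\<close> of \<open>c_window\<close> is exactly sweep
    \<open>K + k + 1\<close>.\<close>
  define M where "M k = d * k + (d - 1)" for k
  have M: "M k + \<nu> = d * (k + 1) + (\<nu> - 1)" if "\<nu> \<in> {1..d}" for k \<nu>
    using that by (auto simp: M_def)
  have lim_M: "filterlim (\<lambda>k. M k + \<nu>) sequentially sequentially" for \<nu>
    unfolding M_def add.assoc by (rule filterlim_period)
  have t_lim: "(\<lambda>k. t (M k + \<nu>)) \<longlonglongrightarrow> 0" for \<nu>
    by (rule filterlim_compose[OF t_tendsto_0 lim_M])
  have scale: "(\<lambda>k. \<Prod>\<nu>=1..d. c js (M k + \<nu>)) \<longlonglongrightarrow> lam js * (\<Prod>\<nu>\<in>{1..<d}. 1 / (1 + 0\<^sup>2))"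
    unfolding c_window by (intro tendsto_intros t_lim) simp
  have entry: "(\<lambda>k. P (M k + \<nu>) $ i \<nu> / c js (M k + \<nu>)) \<longlonglongrightarrow> bvec js \<nu> $ i \<nu>" if \<nu>: "\<nu> \<in> {1..d}" for \<nu>
  proof -
    have mode: "mode (M k + \<nu>) = \<nu>" for k
      unfolding M[OF \<nu>] by (rule P_at(1)[OF \<nu>])
    have "i \<nu> < n \<nu>" using i \<nu> by (auto simp: multi_indices_def)
    then have "\<bar>P (M k + \<nu>) $ i \<nu> / c js (M k + \<nu>) - bvec js \<nu> $ i \<nu>\<bar> \<le> t (M k + \<nu>)" for k
      using P_entry_close[of "i \<nu>" "M k + \<nu>"] by (simp add: mode B_def)
    then have "(\<lambda>k. P (M k + \<nu>) $ i \<nu> / c js (M k + \<nu>) - bvec js \<nu> $ i \<nu>) \<longlonglongrightarrow> 0"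
      by (intro tendsto_0_le[OF t_lim[of \<nu>], of _ 1] always_eventually) (simp add: t_nonneg)
    then show ?thesis by (rule LIM_zero_cancel)
  qed
  have eq: "elem_tensor d n (p (k + (K + 1))) i =
      (\<Prod>\<nu>=1..d. c js (M k + \<nu>)) * (\<Prod>\<nu>=1..d. P (M k + \<nu>) $ i \<nu> / c js (M k + \<nu>))" for k
  proof -
    have "p (k + (K + 1)) \<nu> = P (M k + \<nu>)" if "\<nu> \<in> {1..d}" for \<nu>
      unfolding M[OF that] P_at(2)[OF that] by (simp add: ac_simps)
    then show ?thesis
      using i c_js_nonzero by (simp add: elem_tensor_def flip: prod.distrib)
  qed
  have "(\<lambda>k. (\<Prod>\<nu>=1..d. c js (M k + \<nu>)) * (\<Prod>\<nu>=1..d. P (M k + \<nu>) $ i \<nu> / c js (M k + \<nu>)))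
      \<longlonglongrightarrow> (lam js * (\<Prod>\<nu>\<in>{1..<d}. 1 / (1 + 0\<^sup>2))) * (\<Prod>\<nu>=1..d. bvec js \<nu> $ i \<nu>)"
    by (intro tendsto_mult scale tendsto_prod entry)
  then show "(\<lambda>k. elem_tensor d n (p (k + (K + 1))) i) \<longlonglongrightarrow> lam js * elem_tensor d n (bvec js) i"
    unfolding eq using i by (simp add: elem_tensor_def)
qed

end

section \<open>The case of a single term, and the assembly\<close>

lemma als_rank_one_coeff_nonzero:
  fixes b :: tensor
  assumes b: "b = (\<lambda>i. a * elem_tensor d n u i)"
    and als: "is_ALS d n b p" and k: "k \<ge> 1" and \<mu>: "\<mu> \<in> {1..d}"
    and nz: "vnorm (p (k + 1) \<mu>) \<noteq> 0"
  shows "u \<mu> \<bullet> p (k + 1) \<mu> \<noteq> 0"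
proof
  assume 0: "u \<mu> \<bullet> p (k + 1) \<mu> = 0"
  define y where "y x = (\<lambda>\<nu>. if \<nu> < \<mu> then p (k + 1) \<nu> else if \<nu> = \<mu> then x else p k \<nu>)" for x
  have carr: "p (k + 1) \<mu> \<in> carrier_vec (n \<mu>)" using als \<mu> by (simp add: is_ALS_def)
  have "y (p (k + 1) \<mu>) \<nu> \<in> carrier_vec (n \<nu>)" if "\<nu> \<in> {1..d}" for \<nu>
    using als k that by (auto simp: is_ALS_def y_def)
  then have "tensor_inner d n (elem_tensor d n u) (elem_tensor d n (y (p (k + 1) \<mu>)))
      = (\<Prod>\<nu>=1..d. u \<nu> \<bullet> y (p (k + 1) \<mu>) \<nu>)"
    by (rule tensor_inner_elem_tensor)
  also have "\<dots> = 0"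
    using \<mu> 0 by (intro prod_zero) (auto simp: y_def intro!: bexI[of _ \<mu>])
  finally have "tensor_inner d n b (elem_tensor d n (y (p (k + 1) \<mu>))) = 0"
    by (simp add: b tensor_inner_def mult.assoc flip: sum_distrib_left)
  \<comment> \<open>The update is tested with the new vector itself, so a vanishing coefficient
    would make its norm vanish.\<close>
  moreover have "p (k + 1) \<mu> \<bullet> p (k + 1) \<mu> =
      tensor_inner d n b (elem_tensor d n (y (p (k + 1) \<mu>)))
      / ((\<Prod>\<nu>\<in>{1..<\<mu>}. (vnorm (p (k + 1) \<nu>))\<^sup>2) * (\<Prod>\<nu>\<in>{\<mu><..d}. (vnorm (p k \<nu>))\<^sup>2))"
    using als k \<mu> carr unfolding is_ALS_def y_def by blast
  ultimately have "p (k + 1) \<mu> \<bullet> p (k + 1) \<mu> = 0" by simp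
  then show False using nz by (simp add: vnorm_def)
qed

theorem mainTheorem1:
  fixes d r k0 jstar :: nat
    and n :: "nat \<Rightarrow> nat"
    and lam :: "nat \<Rightarrow> real"
    and bvec :: "nat \<Rightarrow> nat \<Rightarrow> real vec"
    and bterm :: "nat \<Rightarrow> tensor"
    and b :: tensor
    and p :: "nat \<Rightarrow> nat \<Rightarrow> real vec"
  assumes d: "d \<ge> 3"
    and bvec_space: "\<And>j \<mu>. j \<in> {1..r} \<Longrightarrow> \<mu> \<in> {1..d} \<Longrightarrow> bvec j \<mu> \<in> carrier_vec (n \<mu>)"
    and orthonormal: "\<And>i j \<mu>. i \<in> {1..r} \<Longrightarrow> j \<in> {1..r} \<Longrightarrow> \<mu> \<in> {1..d} \<Longrightarrow>
          bvec i \<mu> \<bullet> bvec j \<mu> = (if i = j then 1 else 0)"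
    and lam_pos: "\<And>j. j \<in> {1..r} \<Longrightarrow> lam j > 0"
    and lam_decreasing: "\<And>i j. i \<in> {1..r} \<Longrightarrow> j \<in> {1..r} \<Longrightarrow> i \<le> j \<Longrightarrow> lam j \<le> lam i"
    and bterm: "\<And>j. j \<in> {1..r} \<Longrightarrow> bterm j = (\<lambda>i. lam j * elem_tensor d n (bvec j) i)"
    and b: "b = (\<lambda>i. \<Sum>j=1..r. bterm j i)"
    and ALS: "is_ALS d n b p"
    \<comment> \<open>For \<open>r = 1\<close> the dominance condition is vacuous and does not exclude a breakdown of the
      algorithm (for \<open>r \<ge> 2\<close> it does), so here the run has to be assumed well-defined.\<close>
    and well_defined: "r = 1 \<Longrightarrow> \<forall>k\<ge>1. elem_tensor d n (p k) \<noteq> (\<lambda>i. 0)"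
    and k0: "k0 \<ge> 1"
    and jstar: "jstar \<in> {1..r}"
    and dominates: "\<And>j \<mu>. j \<in> {1..r} - {jstar} \<Longrightarrow> \<mu> \<in> {1..d} \<Longrightarrow>
          lam jstar powr (2 / (real d - 2)) * (bvec jstar \<mu> \<bullet> p k0 \<mu>)\<^sup>2
            > lam j powr (2 / (real d - 2)) * (bvec j \<mu> \<bullet> p k0 \<mu>)\<^sup>2"
  shows "tensor_tendsto d n (\<lambda>k. elem_tensor d n (p k)) (bterm jstar) \<and>
         (\<forall>\<mu>\<in>{1..d}. Q_superlinear_to_0 (\<lambda>k. \<bar>tan (angle (bvec jstar \<mu>) (p k \<mu>))\<bar>))"
proof -
  have b_eq: "b = (\<lambda>i. \<Sum>j=1..r. lam j * elem_tensor d n (bvec j) i)"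
    unfolding b by (intro ext sum.cong refl) (simp add: bterm)
  obtain K where K: "K \<ge> 1"
    and nz: "\<And>\<mu>. \<mu> \<in> {1..d} \<Longrightarrow> bvec jstar \<mu> \<bullet> p K \<mu> \<noteq> 0"
    and dom: "\<And>j \<mu>. j \<in> {1..r} - {jstar} \<Longrightarrow> \<mu> \<in> {1..d} \<Longrightarrow>
          lam j powr (1 / (real d - 2)) * \<bar>bvec j \<mu> \<bullet> p K \<mu>\<bar>
            < lam jstar powr (1 / (real d - 2)) * \<bar>bvec jstar \<mu> \<bullet> p K \<mu>\<bar>"
  proof (cases "r = 1")
    \<comment> \<open>Dominance is vacuous here and says nothing about \<open>p k0\<close>; one
      sweep later, nonzero factors must have nonzero coefficients.\<close>
    case True
    then have js1: "jstar = 1" using jstar by simp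
    have "b = (\<lambda>i. lam 1 * elem_tensor d n (bvec 1) i)" using True by (simp add: b_eq)
    moreover have "vnorm (p (k0 + 1) \<mu>) \<noteq> 0" if "\<mu> \<in> {1..d}" for \<mu>
      using well_defined[OF True] k0 ALS that
      by (intro elem_tensor_nonzero_imp_vnorm[of d n]) (auto simp: is_ALS_def)
    ultimately have "bvec jstar \<mu> \<bullet> p (k0 + 1) \<mu> \<noteq> 0" if "\<mu> \<in> {1..d}" for \<mu>
      unfolding js1 using that ALS k0
      by (intro als_rank_one_coeff_nonzero[of b "lam 1" d n "bvec 1" p k0 \<mu>]) auto
    then show ?thesis using that[of "k0 + 1"] True js1 by simp
  next
    case False
    have sq: "lam j powr (2 / (real d - 2)) * (x::real)\<^sup>2 = (lam j powr (1 / (real d - 2)) * \<bar>x\<bar>)\<^sup>2" for j x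
    proof -
      have "lam j powr (2 / (real d - 2)) = (lam j powr (1 / (real d - 2)))\<^sup>2"
        by (simp add: power2_eq_square flip: powr_add)
      then show ?thesis by (simp only: power_mult_distrib power2_abs)
    qed
    have dom: "lam j powr (1 / (real d - 2)) * \<bar>bvec j \<mu> \<bullet> p k0 \<mu>\<bar>
            < lam jstar powr (1 / (real d - 2)) * \<bar>bvec jstar \<mu> \<bullet> p k0 \<mu>\<bar>"
      if "j \<in> {1..r} - {jstar}" "\<mu> \<in> {1..d}" for j \<mu>
      using dominates[OF that] unfolding sq by (rule power2_less_imp_less) simp
    \<comment> \<open>A competing term exists; strict dominance over its nonnegative weighted
      coefficient excludes a zero dominant one.\<close>
    obtain j where j: "j \<in> {1..r} - {jstar}"
    proof (cases "jstar = 1")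
      case True
      then have "r \<in> {1..r} - {jstar}" using False jstar by auto
      then show ?thesis by (rule that)
    next
      case jstar_ne: False
      then have "1 \<in> {1..r} - {jstar}" using jstar by auto
      then show ?thesis by (rule that)
    qed
    have "bvec jstar \<mu> \<bullet> p k0 \<mu> \<noteq> 0" if "\<mu> \<in> {1..d}" for \<mu>
    proof
      assume 0: "bvec jstar \<mu> \<bullet> p k0 \<mu> = 0"
      have "0 \<le> lam j powr (1 / (real d - 2)) * \<bar>bvec j \<mu> \<bullet> p k0 \<mu>\<bar>" by simp
      then show False using dom[OF j that] unfolding 0 by (simp only: abs_zero mult_zero_right not_less[symmetric])
    qed
    then show ?thesis using k0 dom by (intro that[of k0])
  qed
  interpret als_run d r jstar K n lam bvec b p
    by unfold_locales (fact d bvec_space orthonormal lam_pos b_eq ALS K jstar nz dom)+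
  show ?thesis
    using elem_tensor_tendsto tan_Q_superlinear
    by (auto simp: bterm[OF jstar] intro!: tensor_tendsto_entrywise)
qed

end
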